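(* Let $\mathcal{J}:\mathbb{R}^n\to\mathbb{R}\cup\{\infty\}$ be block-separable nonsmooth, $\mathcal{J}(v)=\mathcal{J}_0(v)+\sum_{i=1}^m\varphi_i(R_iv)$, and proper, coercive, lower semi-continuous, and continuous on its domain, with convex $\operatorname{dom}\mathcal{J}$. Fix $k\in\{1,\dots,m\}$, $N=N_k$, $V=V_k=(\ker R_k)^\perp$, and let $P:\mathbb{R}^N\to V$ be the prolongation isomorphism with $R_kP=\mathrm{Id}$. For $w\in\operatorname{dom}\mathcal{J}$ let $$f_w(v)=f_{w,0}(v)+\psi_w(v),\qquad f_{w,0}(v)=\mathcal{J}_0(w+Pv),\qquad \psi_w(v)=\varphi_k(R_kw+v),\qquad v\in\mathbb{R}^N,$$ and assume that every $f_w$ is convex. Set $$M_w(v)=f_{w,0}(0)+\langle f_{w,0}'(0),v\rangle+M_0(v)+\psi_w(v)$$ for some fixed function $M_0:\mathbb{R}^N\to\mathbb{R}$ (independent of $w$), and assume that $M_w$ is a dominating first-order model for $f_w$ at $0$ for each $w\in\operatorname{dom}\mathcal{J}$. Furthermore assume that $M_0'$ is uniformly monotone, i.e. there are constants $\alpha>0$ and $p>1$ such that $$\alpha\|u-v\|^p\le\langle M_0'(u)-M_0'(v),u-v\rangle\qquad\forall u,v\in\mathbb{R}^N.$$ Then the operator $$\mathcal{M}^{\mathrm{mod}}(w)=w+P\operatorname*{arg\,min}_{v\in\mathbb{R}^N}M_w(v),\qquad w\in\operatorname{dom}\mathcal{J},$$ is an inexact minimization operator for $\mathcal{J}$ and 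$V$.
   Context: $\operatorname{dom}\mathcal{J}=\{x : \mathcal{J}(x)<\infty\}$ (with the topology induced from $\mathbb{R}^n$). Coercive means $\mathcal{J}(v)\to\infty$ as $\|v\|\to\infty$. Block-separable nonsmooth: $R=(R_1,\dots,R_m):\mathbb{R}^n\to\prod_{i=1}^m\mathbb{R}^{N_i}$ is a linear isomorphism with surjective linear components $R_i$, where it is understood that $R_iv=0$ for all $v\in(\ker R_k)^\perp$, $i\ne k$; $\mathcal{J}_0:\mathbb{R}^n\to\mathbb{R}$ is continuously differentiable; the $\varphi_i:\mathbb{R}^{N_i}\to\mathbb{R}\cup\{\infty\}$ are convex, proper, lower semi-continuous; and $\mathcal{J}(v)=\mathcal{J}_0(v)+\sum_{i}\varphi_i(R_iv)$. First-order model: for $f=f_0+\psi$ with $f_0:\mathbb{R}^N\to\mathbb{R}$ continuously differentiable and $0\in\operatorname{dom}\psi$, a functional $M:\mathbb{R}^N\to\mathbb{R}\cup\{\infty\}$ is a first-order model for $f$ at $0$ if there is a continuously differentiable $M_0:\mathbb{R}^N\to\mathbb{R}$ with $M_0(0)=0$, $M_0'(0)=0$ and $M(v)=f_0(0)+\langle f_0'(0),v\rangle+M_0(v)+\psi(v)$ for all $v$. It is dominating if $M(v)\ge f(v)$ for all $v\in\mathbb{R}^N$. Inexact minimization operator for $\mathcal{J}$ and $V$: a map $\mathcal{M}:\operatorname{dom}\mathcal{J}\to\operatorname{dom}\mathcal{J}$ with $\mathcal{M}(w)-w\in V$ for all $w\in\operatorname{dom}\mathcal{J}$, for which there exists a map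 $\tilde{\mathcal{M}}:\operatorname{dom}\mathcal{J}\to\operatorname{dom}\mathcal{J}$ with $\tilde{\mathcal{M}}(w)-w\in V$ for all $w$ such that: $\mathcal{J}(\mathcal{M}(w))\le\mathcal{J}(\tilde{\mathcal{M}}(w))\le\mathcal{J}(w)$ for all $w\in\operatorname{dom}\mathcal{J}$; $\mathcal{J}\circ\tilde{\mathcal{M}}$ is continuous on $\operatorname{dom}\mathcal{J}$; and $\mathcal{J}(\tilde{\mathcal{M}}(w))<\mathcal{J}(w)$ for every $w\in\operatorname{dom}\mathcal{J}$ such that $\mathcal{J}(w)$ is not minimal in $w+V$. *)

theory Defs
  imports "HOL-Analysis.Analysis"
begin

text \<open>
  The block spaces \<open>\<real>\<^sup>N\<^sup>i\<close> have dimensions varying with \<open>i\<close>, so they cannot be types \<open>real ^ 'b\<close>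
  indexed by \<open>i\<close>. They are the coordinate subspaces \<open>coord_space (D i)\<close> of one ambient
  \<open>real ^ 'd\<close>, with \<open>N\<^sub>i = card (D i)\<close> and the inherited Euclidean structure. The type \<open>'d\<close> and
  the sets \<open>D i\<close> are arbitrary (they may overlap), so every family of dimensions occurs.
  Maps on such a space have the ambient type and only their values on the subspace \<open>W\<close> matter;
  hence the carrier argument of the notions below (\<open>UNIV\<close> for the whole space).
\<close>

definition coord_space :: "'d::finite set \<Rightarrow> (real ^ 'd) set" where
  "coord_space D = {x. \<forall>j. j \<notin> D \<longrightarrow> x $ j = 0}"

text \<open>Functionals into \<open>\<real> \<union> {\<infinity>}\<close> have type \<open>ereal\<close>; the value \<open>-\<infinity>\<close> is excluded by \<open>proper_on\<close>.\<close>

definition edom :: "('a \<Rightarrow> ereal) \<Rightarrow> 'a set" where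
  "edom f = {x. f x < \<infinity>}"

definition proper_on :: "'a set \<Rightarrow> ('a \<Rightarrow> ereal) \<Rightarrow> bool" where
  "proper_on W f \<longleftrightarrow> (\<forall>x\<in>W. f x \<noteq> -\<infinity>) \<and> (\<exists>x\<in>W. f x < \<infinity>)"

text \<open>The library's \<open>convex_on\<close> is for real-valued functions only. At \<open>t = 0\<close> and \<open>t = 1\<close> the
  convention \<open>0 * \<infinity> = 0\<close> of \<open>ereal\<close> makes the inequality trivial.\<close>

definition econvex_on :: "'a::real_vector set \<Rightarrow> ('a \<Rightarrow> ereal) \<Rightarrow> bool" where
  "econvex_on W f \<longleftrightarrow> (\<forall>x\<in>W. \<forall>y\<in>W. \<forall>t\<in>{0..1}.
     f ((1 - t) *\<^sub>R x + t *\<^sub>R y) \<le> ereal (1 - t) * f x + ereal t * f y)"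

definition lsc_on :: "'a::topological_space set \<Rightarrow> ('a \<Rightarrow> ereal) \<Rightarrow> bool" where
  "lsc_on W f \<longleftrightarrow> (\<forall>x\<in>W. f x \<le> Liminf (at x within W) f)"

definition coercive :: "('a::real_normed_vector \<Rightarrow> ereal) \<Rightarrow> bool" where
  "coercive f \<longleftrightarrow> (f \<longlongrightarrow> \<infinity>) at_infinity"

text \<open>Used for subspaces \<open>W\<close> only. Derivatives within a subspace are unique on directions in \<open>W\<close>,
  so \<open>frechet_derivative f (at x within W) v\<close> with \<open>v \<in> W\<close> is the pairing \<open>\<langle>f'(x), v\<rangle>\<close>.\<close>

definition C1_on :: "'a::real_normed_vector set \<Rightarrow> ('a \<Rightarrow> real) \<Rightarrow> bool" where
  "C1_on W f \<longleftrightarrow> (\<exists>f' :: 'a \<Rightarrow> 'a \<Rightarrow>\<^sub>L real.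
     (\<forall>x\<in>W. (f has_derivative blinfun_apply (f' x)) (at x within W)) \<and> continuous_on W f')"

definition block_separable_nonsmooth ::
  "nat \<Rightarrow> (nat \<Rightarrow> 'd::finite set) \<Rightarrow> (nat \<Rightarrow> real ^ 'n::finite \<Rightarrow> real ^ 'd) \<Rightarrow>
   (real ^ 'n \<Rightarrow> real) \<Rightarrow> (nat \<Rightarrow> real ^ 'd \<Rightarrow> ereal) \<Rightarrow> (real ^ 'n \<Rightarrow> ereal) \<Rightarrow> bool" where
  "block_separable_nonsmooth m D R J\<^sub>0 \<phi> J \<longleftrightarrow>
     (\<forall>i\<in>{1..m}. linear (R i) \<and> range (R i) = coord_space (D i)) \<and>
     bij_betw (\<lambda>v. \<lambda>i\<in>{1..m}. R i v) UNIV (\<Pi>\<^sub>E i\<in>{1..m}. coord_space (D i)) \<and>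
     (\<forall>i\<in>{1..m}. \<forall>k\<in>{1..m}. i \<noteq> k \<longrightarrow> (\<forall>v\<in>{x. R k x = 0}\<^sup>\<bottom>. R i v = 0)) \<and>
     C1_on UNIV J\<^sub>0 \<and>
     (\<forall>i\<in>{1..m}. econvex_on (coord_space (D i)) (\<phi> i) \<and> proper_on (coord_space (D i)) (\<phi> i) \<and>
        lsc_on (coord_space (D i)) (\<phi> i)) \<and>
     (\<forall>v. J v = ereal (J\<^sub>0 v) + (\<Sum>i\<in>{1..m}. \<phi> i (R i v)))"

text \<open>\<open>P\<close> is only required to be linear on the carrier \<open>W\<close>.\<close>

definition prolongation ::
  "'b::real_vector set \<Rightarrow> 'a::real_vector set \<Rightarrow> ('a \<Rightarrow> 'b) \<Rightarrow> ('b \<Rightarrow> 'a) \<Rightarrow> bool" where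
  "prolongation W V Rk P \<longleftrightarrow>
     (\<forall>u\<in>W. \<forall>v\<in>W. \<forall>a b. P (a *\<^sub>R u + b *\<^sub>R v) = a *\<^sub>R P u + b *\<^sub>R P v) \<and>
     bij_betw P W V \<and> (\<forall>v\<in>W. Rk (P v) = v)"

definition first_order_model ::
  "'b::real_normed_vector set \<Rightarrow> ('b \<Rightarrow> real) \<Rightarrow> ('b \<Rightarrow> ereal) \<Rightarrow> ('b \<Rightarrow> ereal) \<Rightarrow> bool" where
  "first_order_model W f\<^sub>0 \<psi> M \<longleftrightarrow>
     C1_on W f\<^sub>0 \<and> 0 \<in> edom \<psi> \<and>
     (\<exists>M\<^sub>0. C1_on W M\<^sub>0 \<and> M\<^sub>0 0 = 0 \<and> (\<forall>v\<in>W. frechet_derivative M\<^sub>0 (at 0 within W) v = 0) \<and>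
        (\<forall>v\<in>W. M v =
           ereal (f\<^sub>0 0 + frechet_derivative f\<^sub>0 (at 0 within W) v + M\<^sub>0 v) + \<psi> v))"

definition dominating_first_order_model ::
  "'b::real_normed_vector set \<Rightarrow> ('b \<Rightarrow> real) \<Rightarrow> ('b \<Rightarrow> ereal) \<Rightarrow> ('b \<Rightarrow> ereal) \<Rightarrow> bool" where
  "dominating_first_order_model W f\<^sub>0 \<psi> M \<longleftrightarrow>
     first_order_model W f\<^sub>0 \<psi> M \<and> (\<forall>v\<in>W. M v \<ge> ereal (f\<^sub>0 v) + \<psi> v)"

definition uniformly_monotone_derivative ::
  "'b::real_normed_vector set \<Rightarrow> ('b \<Rightarrow> real) \<Rightarrow> bool" where
  "uniformly_monotone_derivative W f \<longleftrightarrow> (\<exists>\<alpha> p :: real. \<alpha> > 0 \<and> p > 1 \<and>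
     (\<forall>u\<in>W. \<forall>v\<in>W. \<alpha> * norm (u - v) powr p \<le>
        frechet_derivative f (at u within W) (u - v) - frechet_derivative f (at v within W) (u - v)))"

definition inexact_minimization_operator ::
  "('a::real_normed_vector \<Rightarrow> ereal) \<Rightarrow> 'a set \<Rightarrow> ('a \<Rightarrow> 'a) \<Rightarrow> bool" where
  "inexact_minimization_operator J V M \<longleftrightarrow>
     (\<forall>w\<in>edom J. M w \<in> edom J \<and> M w - w \<in> V) \<and>
     (\<exists>Mt. (\<forall>w\<in>edom J. Mt w \<in> edom J \<and> Mt w - w \<in> V) \<and>
        (\<forall>w\<in>edom J. J (M w) \<le> J (Mt w) \<and> J (Mt w) \<le> J w) \<and>
        continuous_on (edom J) (J \<circ> Mt) \<and>
        (\<forall>w\<in>edom J. \<not> (\<forall>v\<in>V. J w \<le> J (w + v)) \<longrightarrow> J (Mt w) < J w))"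

end

theory Submission
  imports Defs
begin

text \<open>
  In the variable \<open>u = R\<^sub>k w + v\<close> the model is \<open>g(w, u) + \<phi>\<^sub>k(u)\<close> with \<open>g\<close> jointly continuous and a
  nonsmooth part independent of \<open>w\<close>. Since the model dominates \<open>f\<^sub>w\<close> and agrees with it at \<open>0\<close>, every
  point below the level of \<open>v = 0\<close> stays in the sublevel set \<open>{\<J> \<le> \<J>(w)}\<close>, which is bounded by
  coercivity. This gives existence of the minimizer, descent of \<open>\<J>\<close>, and local boundedness of the
  minimizers \<open>u\<^sub>w\<close>; monotonicity of \<open>M\<^sub>0'\<close> gives uniqueness. By compactness and lower
  semicontinuity \<open>w \<mapsto> u\<^sub>w\<close> is continuous, so \<open>\<M>\<^sup>m\<^sup>o\<^sup>d\<close> is continuous into \<open>dom \<J>\<close>, and it serves as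
  its own \<open>\<M>\<close>-tilde. Strict decrease holds because the model and the convex \<open>f\<^sub>w\<close> agree to first
  order at \<open>0\<close>, so a descent direction of \<open>f\<^sub>w\<close> is one of the model.
\<close>

section \<open>Extended-real sums and linear extension from coordinate subspaces\<close>

lemma sum_not_MInfty:
  fixes f :: "'a \<Rightarrow> ereal"
  assumes "\<And>i. i \<in> A \<Longrightarrow> f i \<noteq> -\<infinity>"
  shows "sum f A \<noteq> -\<infinity>"
  using assms by (induction A rule: infinite_finite_induct) auto

lemma subspace_coord_space: "subspace (coord_space D)"
  by (auto simp: subspace_def coord_space_def)

text \<open>Composing \<open>P\<close> with the coordinate projection onto
  \<open>coord_space D\<close> leaves its values there unchanged. The result is linear on the whole
  type, so the library facts on linear maps, continuity in particular, apply to it.\<close>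

lemma prolongation_linear_extension:
  fixes P :: "real ^ 'd::finite \<Rightarrow> 'a::real_vector"
  assumes "prolongation (coord_space D) V Rk P"
  obtains Q where "linear Q" and "\<And>v. v \<in> coord_space D \<Longrightarrow> Q v = P v"
proof -
  define pr :: "real ^ 'd \<Rightarrow> real ^ 'd" where "pr x = (\<chi> j. if j \<in> D then x $ j else 0)" for x
  have pr_mem: "pr x \<in> coord_space D" for x
    by (simp add: pr_def coord_space_def)
  have lin: "P (a *\<^sub>R u + b *\<^sub>R v) = a *\<^sub>R P u + b *\<^sub>R P v"
    if "u \<in> coord_space D" "v \<in> coord_space D" for a b u v
    using assms that unfolding prolongation_def by blast
  have pr_add: "pr (x + y) = pr x + pr y" and pr_scale: "pr (r *\<^sub>R x) = r *\<^sub>R pr x" for x y r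
    by (simp_all add: pr_def vec_eq_iff)
  have "linear (\<lambda>x. P (pr x))"
  proof (rule linearI)
    show "P (pr (x + y)) = P (pr x) + P (pr y)" for x y
      using lin[OF pr_mem pr_mem, of 1 x 1 y] by (simp add: pr_add)
    show "P (pr (r *\<^sub>R x)) = r *\<^sub>R P (pr x)" for r x
      using lin[OF pr_mem pr_mem, of r x 0 x] by (simp add: pr_scale)
  qed
  moreover have "P (pr v) = P v" if "v \<in> coord_space D" for v
  proof -
    have "pr v = v" using that by (auto simp: pr_def coord_space_def vec_eq_iff)
    then show ?thesis by simp
  qed
  ultimately show ?thesis using that by blast
qed

section \<open>Calculus on subspaces\<close>

text \<open>Chain rule: the whole line stays in \<open>W\<close>, so a derivative within
  \<open>W\<close> gives an ordinary two-sided derivative in \<open>t\<close>. This reduces later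
  arguments to one real variable.\<close>

lemma has_real_derivative_along_line:
  fixes f :: "'a::real_normed_vector \<Rightarrow> real"
  assumes f: "(f has_derivative f') (at (x + t *\<^sub>R v) within W)"
    and W: "subspace W" and mem: "x \<in> W" "v \<in> W"
  shows "((\<lambda>t. f (x + t *\<^sub>R v)) has_real_derivative f' v) (at t)"
proof -
  have sub: "range (\<lambda>t. x + t *\<^sub>R v) \<subseteq> W"
    using W mem by (auto intro!: subspace_add subspace_scale)
  have line: "((\<lambda>t. x + t *\<^sub>R v) has_derivative (\<lambda>h. h *\<^sub>R v)) (at t)"
    by (auto intro!: derivative_eq_intros)
  have "((\<lambda>t. f (x + t *\<^sub>R v)) has_derivative (\<lambda>h. f' (h *\<^sub>R v))) (at t)"
    using has_derivative_in_compose[OF line, of f f'] has_derivative_subset[OF f sub] by simp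
  moreover have "f' (h *\<^sub>R v) = f' v * h" for h
    using linear_cmul[OF has_derivative_linear[OF f], of h v] by simp
  ultimately show ?thesis by (simp add: has_field_derivative_def)
qed

lemma C1_on_has_frechet_derivative:
  assumes "C1_on W f" "x \<in> W"
  shows "(f has_derivative frechet_derivative f (at x within W)) (at x within W)"
  using assms frechet_derivative_works unfolding C1_on_def differentiable_def by blast

lemma C1_on_imp_continuous_on: "C1_on W f \<Longrightarrow> continuous_on W f"
  unfolding C1_on_def by (auto intro: has_derivative_continuous_on)

text \<open>Along the segment from \<open>x\<close> to \<open>y\<close> the monotonicity bound makes
  the derivative strictly increasing. The mean value theorem on the two halves then gives a smaller
  increment on the first half than on the second. This strict midpoint convexity is what uniqueness
  of minimizers rests on.\<close>

lemma uniformly_monotone_derivative_midpoint_less: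
  fixes f :: "'a::real_normed_vector \<Rightarrow> real"
  assumes mono: "uniformly_monotone_derivative W f" and C1: "C1_on W f" and W: "subspace W"
    and mem: "x \<in> W" "y \<in> W" and "x \<noteq> y"
  shows "f ((1/2) *\<^sub>R x + (1/2) *\<^sub>R y) < (f x + f y) / 2"
proof -
  define v where "v = y - x"
  have v: "v \<in> W" "v \<noteq> 0"
    using W mem \<open>x \<noteq> y\<close> by (auto simp: v_def subspace_diff)
  define h where "h t = f (x + t *\<^sub>R v)" for t
  define h' where "h' t = frechet_derivative f (at (x + t *\<^sub>R v) within W) v" for t
  have line: "x + t *\<^sub>R v \<in> W" for t
    using W mem v by (intro subspace_add subspace_scale)
  have deriv: "(h has_real_derivative h' t) (at t)" for t
    unfolding h_def h'_def
    using has_real_derivative_along_line[OF C1_on_has_frechet_derivative[OF C1 line] W mem(1) v(1)] .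
  have h'_less: "h' s < h' t" if "s < t" for s t
  proof -
    obtain \<alpha> p where "\<alpha> > 0" and *: "\<And>u z. u \<in> W \<Longrightarrow> z \<in> W \<Longrightarrow> \<alpha> * norm (u - z) powr p \<le>
        frechet_derivative f (at u within W) (u - z) - frechet_derivative f (at z within W) (u - z)"
      using mono unfolding uniformly_monotone_derivative_def by blast
    have diff: "(x + t *\<^sub>R v) - (x + s *\<^sub>R v) = (t - s) *\<^sub>R v"
      by (simp add: algebra_simps)
    have lin: "frechet_derivative f (at (x + r *\<^sub>R v) within W) ((t - s) *\<^sub>R v) = (t - s) * h' r" for r
      using linear_cmul[OF has_derivative_linear[OF C1_on_has_frechet_derivative[OF C1 line]]]
      by (simp add: h'_def)
    have "0 < \<alpha> * norm ((t - s) *\<^sub>R v) powr p"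
      using \<open>\<alpha> > 0\<close> v that by simp
    also have "\<dots> \<le> (t - s) * h' t - (t - s) * h' s"
      using *[OF line[of t] line[of s]] unfolding diff lin .
    finally have "0 < (t - s) * (h' t - h' s)"
      by (simp add: algebra_simps)
    then show ?thesis
      using that by (simp add: zero_less_mult_iff)
  qed
  obtain r where r: "0 < r" "r < 1/2" "h (1/2) - h 0 = (1/2 - 0) * h' r"
    using MVT2[of 0 "1/2" h h'] deriv by auto
  obtain s where s: "1/2 < s" "s < 1" "h 1 - h (1/2) = (1 - 1/2) * h' s"
    using MVT2[of "1/2" 1 h h'] deriv by auto
  have "h (1/2) < (h 0 + h 1) / 2"
    using h'_less[of r s] r s by simp
  moreover have "x + (1/2) *\<^sub>R v = (1/2) *\<^sub>R x + (1/2) *\<^sub>R y"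
  proof -
    have "x - (1/2) *\<^sub>R x = (1/2) *\<^sub>R x"
      using scaleR_left_diff_distrib[of 1 "1/2" x, symmetric] unfolding scaleR_one by simp
    then show ?thesis by (simp add: v_def scaleR_diff_right)
  qed
  ultimately show ?thesis by (simp add: h_def v_def)
qed

section \<open>Lower semicontinuity and minimizers\<close>

text \<open>The bound \<open>a n\<close> may vary because, in the applications, it absorbs a
  continuous term evaluated along the sequence.\<close>

lemma lsc_on_sequentially_le:
  fixes f :: "'a::metric_space \<Rightarrow> ereal"
  assumes lsc: "lsc_on W f" and "x \<in> W" and X: "\<And>n. X n \<in> W" "X \<longlonglongrightarrow> x"
    and le: "\<And>n. f (X n) \<le> ereal (a n)" and a: "a \<longlonglongrightarrow> l"
  shows "f x \<le> ereal l"
proof (rule ccontr)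
  assume "\<not> f x \<le> ereal l"
  then have "ereal l < f x" by (simp only: not_le)
  then obtain b where b: "ereal l < ereal b" "ereal b < f x"
    using ereal_dense2 by blast
  have "f x \<le> Liminf (at x within W) f"
    using lsc \<open>x \<in> W\<close> by (simp add: lsc_on_def)
  then have "\<forall>\<^sub>F y in at x within W. ereal b < f y"
    using b by (intro less_LiminfD) simp
  \<comment> \<open>\<open>Liminf\<close> ignores the point \<open>x\<close> itself, which the
    sequence may visit; \<open>ereal b < f x\<close> fills this gap.\<close>
  then have "\<forall>\<^sub>F y in nhds x. y \<in> W \<longrightarrow> ereal b < f y"
    using b by (auto simp: eventually_at_filter elim: eventually_mono)
  then have "\<forall>\<^sub>F n in sequentially. ereal b < f (X n)"
    using X by (auto dest: eventually_compose_filterlim)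
  moreover have "\<forall>\<^sub>F n in sequentially. a n < b"
    using a b by (auto intro: order_tendstoD)
  ultimately have "\<forall>\<^sub>F n in sequentially. False"
  proof eventually_elim
    case (elim n)
    have "ereal b < ereal (a n)"
      using elim(1) le[of n] by (rule less_le_trans)
    with elim(2) show False by simp
  qed
  then show False by simp
qed

text \<open>Direct method: a minimizing sequence in the bounded sublevel set of \<open>u0\<close>
  has a convergent subsequence, whose limit lies in the closed set \<open>W\<close> and is a
  minimizer by lower semicontinuity.\<close>

lemma exists_minimizer_continuous_plus_lsc:
  fixes \<phi> :: "'a::heine_borel \<Rightarrow> ereal"
  assumes W: "closed W" and g: "continuous_on W g" and lsc: "lsc_on W \<phi>"
    and u0: "u0 \<in> W" "\<phi> u0 < \<infinity>"
    and bdd: "bounded {u \<in> W. ereal (g u) + \<phi> u \<le> ereal (g u0) + \<phi> u0}"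
  shows "\<exists>u\<in>W. \<forall>u'\<in>W. ereal (g u) + \<phi> u \<le> ereal (g u') + \<phi> u'"
proof -
  define G where "G u = ereal (g u) + \<phi> u" for u
  define K where "K = {u \<in> W. G u \<le> G u0}"
  have "G ` K \<noteq> {}" using u0 by (auto simp: K_def)
  then obtain y where y: "\<And>n. y n \<in> G ` K" "y \<longlonglongrightarrow> Inf (G ` K)"
    using Inf_as_limit[of "G ` K"] by auto
  have "\<forall>n. \<exists>x. x \<in> K \<and> y n = G x"
    using y(1) by blast
  then obtain U where U: "\<And>n. U n \<in> K" "\<And>n. y n = G (U n)"
    using choice[of "\<lambda>n x. x \<in> K \<and> y n = G x"] by blast
  have "bounded (range U)"
    using bdd U(1) unfolding K_def G_def by (auto elim: bounded_subset)
  then obtain u r where r: "strict_mono (r :: nat \<Rightarrow> nat)" and lim: "(U \<circ> r) \<longlonglongrightarrow> u"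
    using bounded_imp_convergent_subsequence by blast
  have UW: "(U \<circ> r) n \<in> W" for n
    using U(1) by (simp add: K_def)
  have uW: "u \<in> W"
    using closed_sequentially[OF W, of "U \<circ> r"] UW lim by auto
  have glim: "(\<lambda>n. g ((U \<circ> r) n)) \<longlonglongrightarrow> g u"
    using continuous_on_tendsto_compose[OF g lim uW] UW by simp
  \<comment> \<open>The infimum could a priori be infinite, so the limit is compared with a real
    \<open>c\<close> strictly between the infimum and \<open>G u\<close>.\<close>
  have "G u \<le> Inf (G ` K)"
  proof (rule ccontr)
    assume "\<not> G u \<le> Inf (G ` K)"
    then have "Inf (G ` K) < G u" by (simp only: not_le)
    then obtain c where c: "Inf (G ` K) < ereal c" "ereal c < G u"
      using ereal_dense2 by blast
    have "(\<lambda>n. y (r n)) \<longlonglongrightarrow> Inf (G ` K)"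
      using LIMSEQ_subseq_LIMSEQ[OF y(2) r] by (simp add: o_def)
    then have "\<forall>\<^sub>F n in sequentially. y (r n) < ereal c"
      using c by (auto intro: order_tendstoD)
    then obtain n0 where n0: "\<And>n. n \<ge> n0 \<Longrightarrow> G ((U \<circ> r) n) < ereal c"
      using U(2) by (auto simp: eventually_sequentially)
    \<comment> \<open>Shifting by \<open>n0\<close> makes the bound valid at every index, as the
      sequential lemma demands.\<close>
    have le: "\<phi> ((U \<circ> r) (n + n0)) \<le> ereal (c - g ((U \<circ> r) (n + n0)))" for n
      using n0[of "n + n0"] unfolding G_def
      by (cases "\<phi> ((U \<circ> r) (n + n0))") auto
    have "(\<lambda>n. (U \<circ> r) (n + n0)) \<longlonglongrightarrow> u"
      using lim by (rule LIMSEQ_ignore_initial_segment)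
    moreover have "(\<lambda>n. c - g ((U \<circ> r) (n + n0))) \<longlonglongrightarrow> c - g u"
      using LIMSEQ_ignore_initial_segment[OF glim] by (intro tendsto_intros)
    ultimately have "\<phi> u \<le> ereal (c - g u)"
      using lsc_on_sequentially_le[OF lsc uW, of "\<lambda>n. (U \<circ> r) (n + n0)", OF UW _ le] by blast
    with c(2) show False unfolding G_def by (cases "\<phi> u") auto
  qed
  then have K: "G u \<le> G u'" if "u' \<in> K" for u'
    using order_trans[OF _ INF_lower[OF that]] by simp
  have "G u \<le> G u'" if "u' \<in> W" for u'
  proof (cases "u' \<in> K")
    case False
    then have "G u0 \<le> G u'" using that by (simp add: K_def)
    moreover have "G u \<le> G u0" using K u0 by (simp add: K_def)
    ultimately show ?thesis by (rule order_trans[rotated])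
  qed (rule K)
  then show ?thesis using uW unfolding G_def by blast
qed

text \<open>Because the nonsmooth part does not depend on the parameter, the minimizer at the limit
  parameter serves as a constant recovery sequence.\<close>

lemma continuous_on_unique_minimizer:
  fixes \<phi> :: "'a::heine_borel \<Rightarrow> ereal" and u :: "'b::metric_space \<Rightarrow> 'a"
  assumes W: "closed W" and g: "continuous_on (X \<times> W) (\<lambda>(x, u). g x u)" and lsc: "lsc_on W \<phi>"
    and u: "\<And>x. x \<in> X \<Longrightarrow> u x \<in> W" and fin: "\<And>x. x \<in> X \<Longrightarrow> \<bar>\<phi> (u x)\<bar> \<noteq> \<infinity>"
    and min: "\<And>x u'. x \<in> X \<Longrightarrow> u' \<in> W \<Longrightarrow> ereal (g x (u x)) + \<phi> (u x) \<le> ereal (g x u') + \<phi> u'"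
    and unique: "\<And>x u'. x \<in> X \<Longrightarrow> u' \<in> W \<Longrightarrow>
      ereal (g x u') + \<phi> u' \<le> ereal (g x (u x)) + \<phi> (u x) \<Longrightarrow> u' = u x"
    and bdd: "\<And>x. x \<in> X \<Longrightarrow> \<exists>B. bounded B \<and> (\<forall>\<^sub>F y in at x within X. u y \<in> B)"
  shows "continuous_on X u"
  unfolding continuous_on_sequentially
proof (intro allI ballI impI)
  fix s a assume a: "a \<in> X" and s: "(\<forall>n. s n \<in> X) \<and> s \<longlonglongrightarrow> a"
  show "(u \<circ> s) \<longlonglongrightarrow> u a"
  proof (rule ccontr)
    assume "\<not> (u \<circ> s) \<longlonglongrightarrow> u a"
    then obtain e where e: "e > 0" and "\<not> (\<forall>\<^sub>F n in sequentially. dist (u (s n)) (u a) < e)"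
      unfolding tendsto_iff by auto
    \<comment> \<open>Infinitely many terms stay at distance \<open>e\<close> from
      \<open>u a\<close>. A convergent subsequence of them will have a limit \<open>l\<close> that
      is again a minimizer at \<open>a\<close>, contradicting uniqueness.\<close>
    then have inf: "\<exists>\<^sub>F n in sequentially. e \<le> dist (u (s n)) (u a)"
      by (simp add: frequently_def not_le)
    obtain B where B: "bounded B" "\<forall>\<^sub>F y in at a within X. u y \<in> B"
      using bdd[OF a] by blast
    \<comment> \<open>The filter \<open>at a within X\<close> omits \<open>a\<close>, so
      \<open>u a\<close> is added to the bounded set.\<close>
    then have "\<forall>\<^sub>F y in nhds a. y \<in> X \<longrightarrow> u y \<in> insert (u a) B"
      by (auto simp: eventually_at_filter elim: eventually_mono)
    then have "\<forall>\<^sub>F n in sequentially. u (s n) \<in> insert (u a) B"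
      using s by (auto dest: eventually_compose_filterlim)
    with inf have "\<exists>\<^sub>F n in sequentially. e \<le> dist (u (s n)) (u a) \<and> u (s n) \<in> insert (u a) B"
      by (rule frequently_eventually_frequently)
    then have "infinite {n. e \<le> dist (u (s n)) (u a) \<and> u (s n) \<in> insert (u a) B}"
      by (simp add: frequently_cofinite flip: cofinite_eq_sequentially)
    then obtain q where q: "strict_mono (q :: nat \<Rightarrow> nat)"
      and sep: "\<And>n. e \<le> dist (u (s (q n))) (u a)" and qB: "\<And>n. u (s (q n)) \<in> insert (u a) B"
      using infinite_enumerate by blast
    have "bounded (range (\<lambda>n. u (s (q n))))"
      by (rule bounded_subset[of "insert (u a) B"]) (use B qB in auto)
    then obtain r l where r: "strict_mono (r :: nat \<Rightarrow> nat)" and "((\<lambda>n. u (s (q n))) \<circ> r) \<longlonglongrightarrow> l"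
      using bounded_imp_convergent_subsequence by blast
    define z where "z n = s (q (r n))" for n
    have ul: "(\<lambda>n. u (z n)) \<longlonglongrightarrow> l"
      using \<open>((\<lambda>n. u (s (q n))) \<circ> r) \<longlonglongrightarrow> l\<close> by (simp add: z_def o_def)
    have zX: "z n \<in> X" for n using s by (simp add: z_def)
    have za: "z \<longlonglongrightarrow> a"
      using LIMSEQ_subseq_LIMSEQ[OF _ strict_mono_o[OF q r], of s a] s by (simp add: z_def[abs_def] o_def)
    have lW: "l \<in> W"
      using closed_sequentially[OF W, of "\<lambda>n. u (z n)"] u[OF zX] ul by auto
    have g1: "(\<lambda>n. g (z n) (u (z n))) \<longlonglongrightarrow> g a l"
      using continuous_on_tendsto_compose[OF g tendsto_Pair[OF za ul]] a lW u[OF zX] zX by simp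
    have g2: "(\<lambda>n. g (z n) (u a)) \<longlonglongrightarrow> g a (u a)"
      using continuous_on_tendsto_compose[OF g tendsto_Pair[OF za tendsto_const[of "u a"]]] a u[OF a] zX
      by simp
    obtain b where b: "\<phi> (u a) = ereal b" using fin[OF a] by auto
    have le: "\<phi> (u (z n)) \<le> ereal (g (z n) (u a) + b - g (z n) (u (z n)))" for n
      using min[OF zX u[OF a], of n] b by (cases "\<phi> (u (z n))") auto
    have "(\<lambda>n. g (z n) (u a) + b - g (z n) (u (z n))) \<longlonglongrightarrow> g a (u a) + b - g a l"
      by (intro tendsto_intros g1 g2)
    then have "\<phi> l \<le> ereal (g a (u a) + b - g a l)"
      by (rule lsc_on_sequentially_le[OF lsc lW u[OF zX] ul le])
    then have "ereal (g a l) + \<phi> l \<le> ereal (g a (u a)) + \<phi> (u a)"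
      using b by (cases "\<phi> l") auto
    then have "l = u a" by (rule unique[OF a lW])
    moreover have "e \<le> dist l (u a)"
      by (rule tendsto_lowerbound[OF tendsto_dist[OF ul tendsto_const]])
        (use sep in \<open>auto simp: z_def\<close>)
    ultimately show False using e by simp
  qed
qed

section \<open>First-order models\<close>

lemma first_order_model_zero:
  assumes "first_order_model W f\<^sub>0 \<psi> M" and W: "subspace W"
  shows "M 0 = ereal (f\<^sub>0 0) + \<psi> 0"
proof -
  have "C1_on W f\<^sub>0" and z: "0 \<in> W"
    using assms by (auto simp: first_order_model_def subspace_0)
  then have "frechet_derivative f\<^sub>0 (at 0 within W) 0 = 0"
    using linear_0[OF has_derivative_linear[OF C1_on_has_frechet_derivative]] by blast
  then show ?thesis
    using assms z unfolding first_order_model_def by auto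
qed

text \<open>Convexity forces a decrease of \<open>f\<^sub>0 + \<psi>\<close> at least linear in
  \<open>t\<close> along \<open>t *\<^sub>R v\<close>. The model differs from this function only by
  terms with vanishing derivative at 0, so it decreases too for small \<open>t\<close>.\<close>

lemma first_order_model_descent:
  fixes f\<^sub>0 :: "'b::real_normed_vector \<Rightarrow> real"
  assumes model: "first_order_model W f\<^sub>0 \<psi> M" and W: "subspace W"
    and conv: "econvex_on W (\<lambda>v. ereal (f\<^sub>0 v) + \<psi> v)"
    and ninf: "\<And>v. v \<in> W \<Longrightarrow> \<psi> v \<noteq> -\<infinity>"
    and v: "v \<in> W" "ereal (f\<^sub>0 v) + \<psi> v < ereal (f\<^sub>0 0) + \<psi> 0"
  shows "\<exists>u\<in>W. M u < M 0"
proof -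
  obtain M\<^sub>0 where C1: "C1_on W f\<^sub>0" "C1_on W M\<^sub>0" and M0: "M\<^sub>0 0 = 0"
    and dM0: "\<And>v. v \<in> W \<Longrightarrow> frechet_derivative M\<^sub>0 (at 0 within W) v = 0"
    and M: "\<And>v. v \<in> W \<Longrightarrow>
      M v = ereal (f\<^sub>0 0 + frechet_derivative f\<^sub>0 (at 0 within W) v + M\<^sub>0 v) + \<psi> v"
    and "\<psi> 0 < \<infinity>"
    using model unfolding first_order_model_def edom_def by auto
  have z: "0 \<in> W" using W by (rule subspace_0)
  obtain b where b: "\<psi> 0 = ereal b"
    using ninf[OF z] \<open>\<psi> 0 < \<infinity>\<close> by (cases "\<psi> 0") auto
  obtain c where c: "\<psi> v = ereal c"
    using ninf[OF v(1)] v(2) b by (cases "\<psi> v") auto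
  define d where "d = frechet_derivative f\<^sub>0 (at 0 within W) v"
  define \<delta> where "\<delta> = f\<^sub>0 0 + b - (f\<^sub>0 v + c)"
  have "\<delta> > 0" using v b c by (simp add: \<delta>_def)
  \<comment> \<open>Replacing \<open>\<psi> (t *\<^sub>R v)\<close> in the model by its bound from
    convexity of the full sum leaves \<open>h t\<close> plus the constant
    \<open>2 * f\<^sub>0 0 + b\<close>. The two occurrences of \<open>d\<close> cancel in the
    derivative, so \<open>h\<close> has slope \<open>- \<delta>\<close> at 0.\<close>
  define h where "h t = t * d + M\<^sub>0 (0 + t *\<^sub>R v) - f\<^sub>0 (0 + t *\<^sub>R v) - t * \<delta>" for t
  have line: "((\<lambda>t. g (0 + t *\<^sub>R v)) has_real_derivative frechet_derivative g (at 0 within W) v) (at 0)"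
    if "C1_on W g" for g
    using has_real_derivative_along_line[of g _ 0 0 v W] C1_on_has_frechet_derivative[OF that z] W z v(1)
    by simp
  have "(h has_real_derivative (1 * d + frechet_derivative M\<^sub>0 (at 0 within W) v
      - frechet_derivative f\<^sub>0 (at 0 within W) v - 1 * \<delta>)) (at 0)"
    unfolding h_def by (intro derivative_intros DERIV_cmult_right line C1)
  then have "(h has_real_derivative - \<delta>) (at 0)"
    using dM0[OF v(1)] by (simp add: d_def)
  then obtain e where e: "e > 0" "\<And>t. t > 0 \<Longrightarrow> t < e \<Longrightarrow> h (0 + t) < h 0"
    using DERIV_neg_dec_right[of h "-\<delta>" 0] \<open>\<delta> > 0\<close> by auto
  \<comment> \<open>Below \<open>e\<close> for the decrease of \<open>h\<close>, at most 1 for the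
    convexity inequality.\<close>
  define t where "t = min (e/2) 1"
  have t: "0 < t" "t < e" "t \<le> 1" using e(1) by (auto simp: t_def)
  have tv: "t *\<^sub>R v \<in> W" using W v(1) by (rule subspace_scale)
  have "ereal (f\<^sub>0 (t *\<^sub>R v)) + \<psi> (t *\<^sub>R v) \<le> ereal (1 - t) * (ereal (f\<^sub>0 0) + \<psi> 0) + ereal t * (ereal (f\<^sub>0 v) + \<psi> v)"
    using conv[unfolded econvex_on_def, rule_format, OF z v(1), of t] t by simp
  then have "ereal (f\<^sub>0 (t *\<^sub>R v)) + \<psi> (t *\<^sub>R v) \<le> ereal (f\<^sub>0 0 + b - t * \<delta>)"
    using b c by (simp add: \<delta>_def algebra_simps)
  then have "\<psi> (t *\<^sub>R v) \<le> ereal (f\<^sub>0 0 + b - t * \<delta> - f\<^sub>0 (t *\<^sub>R v))"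
    by (cases "\<psi> (t *\<^sub>R v)") auto
  moreover have "frechet_derivative f\<^sub>0 (at 0 within W) (t *\<^sub>R v) = t * d"
    using linear_cmul[OF has_derivative_linear[OF C1_on_has_frechet_derivative[OF C1(1) z]]]
    by (simp add: d_def)
  ultimately have "M (t *\<^sub>R v) \<le> ereal (f\<^sub>0 0 + t * d + M\<^sub>0 (t *\<^sub>R v)) + ereal (f\<^sub>0 0 + b - t * \<delta> - f\<^sub>0 (t *\<^sub>R v))"
    unfolding M[OF tv] by (simp only: add_left_mono)
  also have "\<dots> = ereal (h t + (2 * f\<^sub>0 0 + b))"
    by (simp add: h_def)
  also have "\<dots> < ereal (h 0 + (2 * f\<^sub>0 0 + b))"
    using e(2) t by simp
  also have "\<dots> = M 0"
    using first_order_model_zero[OF model W] M0 b by (simp add: h_def)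
  finally show ?thesis using tv by blast
qed

section \<open>Coercivity\<close>

lemma coercive_bounded_sublevel:
  assumes "coercive J"
  shows "bounded {x. J x \<le> ereal c}"
proof -
  have "\<forall>\<^sub>F x in at_infinity. ereal c < J x"
    using assms by (auto simp: coercive_def tendsto_PInfty)
  then obtain b where b: "\<And>x. b \<le> norm x \<Longrightarrow> ereal c < J x"
    by (auto simp: eventually_at_infinity)
  have "norm x \<le> b" if "J x \<le> ereal c" for x
    using b[of x] that by (cases "norm x \<le> b") auto
  then show ?thesis
    unfolding bounded_iff by blast
qed

theorem theorem5p6:
  fixes m k :: nat
    and D :: "nat \<Rightarrow> 'd::finite set"
    and R :: "nat \<Rightarrow> real ^ 'n::finite \<Rightarrow> real ^ 'd"
    and J\<^sub>0 :: "real ^ 'n \<Rightarrow> real"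
    and \<phi> :: "nat \<Rightarrow> real ^ 'd \<Rightarrow> ereal"
    and J :: "real ^ 'n \<Rightarrow> ereal"
    and W :: "(real ^ 'd) set"
    and V :: "(real ^ 'n) set"
    and P :: "real ^ 'd \<Rightarrow> real ^ 'n"
    and f\<^sub>0 :: "real ^ 'n \<Rightarrow> real ^ 'd \<Rightarrow> real"
    and \<psi> :: "real ^ 'n \<Rightarrow> real ^ 'd \<Rightarrow> ereal"
    and f :: "real ^ 'n \<Rightarrow> real ^ 'd \<Rightarrow> ereal"
    and M\<^sub>0 :: "real ^ 'd \<Rightarrow> real"
    and M :: "real ^ 'n \<Rightarrow> real ^ 'd \<Rightarrow> ereal"
  assumes "block_separable_nonsmooth m D R J\<^sub>0 \<phi> J"
    and "proper_on UNIV J"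
    and "coercive J"
    and "lsc_on UNIV J"
    and "continuous_on (edom J) J"
    and "convex (edom J)"
    and "k \<in> {1..m}"
  defines "W \<equiv> coord_space (D k)"
    and "V \<equiv> {x. R k x = 0}\<^sup>\<bottom>"
  assumes "prolongation W V (R k) P"
  defines "f\<^sub>0 \<equiv> \<lambda>w v. J\<^sub>0 (w + P v)"
    and "\<psi> \<equiv> \<lambda>w v. \<phi> k (R k w + v)"
    and "f \<equiv> \<lambda>w v. ereal (f\<^sub>0 w v) + \<psi> w v"
    and "M \<equiv> \<lambda>w v. ereal (f\<^sub>0 w 0 + frechet_derivative (f\<^sub>0 w) (at 0 within W) v + M\<^sub>0 v) + \<psi> w v"
  assumes "\<And>w. w \<in> edom J \<Longrightarrow> econvex_on W (f w)"
    and "C1_on W M\<^sub>0"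
    and "\<And>w. w \<in> edom J \<Longrightarrow> dominating_first_order_model W (f\<^sub>0 w) (\<psi> w) (M w)"
    and "uniformly_monotone_derivative W M\<^sub>0"
  shows "(\<forall>w\<in>edom J. \<exists>!v. is_arg_min (M w) (\<lambda>v. v \<in> W) v) \<and>
    inexact_minimization_operator J V (\<lambda>w. w + P (arg_min_on (M w) W))"
proof -

  \<comment> \<open>Unpacking the block structure\<close>
  have block: "linear (R i) \<and> range (R i) = coord_space (D i)"
    "econvex_on (coord_space (D i)) (\<phi> i) \<and> proper_on (coord_space (D i)) (\<phi> i) \<and>
      lsc_on (coord_space (D i)) (\<phi> i)" if "i \<in> {1..m}" for i
    using assms(1) that unfolding block_separable_nonsmooth_def by blast+
  have R_zero: "R i v = 0" if "i \<in> {1..m}" "i \<noteq> k" "v \<in> V" for i v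
    using assms(1) \<open>k \<in> {1..m}\<close> that unfolding block_separable_nonsmooth_def V_def by blast
  have J_eq: "J v = ereal (J\<^sub>0 v) + (\<Sum>i\<in>{1..m}. \<phi> i (R i v))" for v
    using assms(1) unfolding block_separable_nonsmooth_def by blast
  obtain J' :: "real ^ 'n \<Rightarrow> (real ^ 'n) \<Rightarrow>\<^sub>L real"
    where J': "\<And>x. (J\<^sub>0 has_derivative J' x) (at x)" and J'_cont: "continuous_on UNIV J'"
    using assms(1) unfolding block_separable_nonsmooth_def C1_on_def by auto
  have J0_cont: "continuous_on UNIV J\<^sub>0"
    using J' by (intro has_derivative_continuous_on) auto
  have W: "subspace W" "closed W"
    unfolding W_def by (simp_all add: subspace_coord_space closed_subspace)
  have W0: "0 \<in> W" using W(1) by (rule subspace_0)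
  have R_lin: "linear (R k)" and RW: "R k x \<in> W" for x
    using block(1)[OF \<open>k \<in> {1..m}\<close>] unfolding W_def by auto
  have R_cont: "continuous_on A (R k)" for A
    using R_lin by (rule linear_continuous_on_compose[OF continuous_on_id])
  have \<phi>_conv: "econvex_on W (\<phi> k)" and \<phi>_lsc: "lsc_on W (\<phi> k)"
    using block(2)[OF \<open>k \<in> {1..m}\<close>] unfolding W_def by auto
  have \<phi>_ninf: "\<phi> i (R i x) \<noteq> -\<infinity>" if "i \<in> {1..m}" for i x
    using block[OF that] unfolding proper_on_def by blast
  have \<phi>k_ninf: "\<phi> k v \<noteq> -\<infinity>" if "v \<in> W" for v
    using block(2)[OF \<open>k \<in> {1..m}\<close>] that unfolding W_def proper_on_def by blast
  have PV: "P v \<in> V" and RP: "R k (P v) = v" if "v \<in> W" for v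
    using assms(10) that unfolding prolongation_def by (auto dest: bij_betwE)
  have V_img: "\<exists>v\<in>W. x = P v" if "x \<in> V" for x
    using assms(10) that unfolding prolongation_def bij_betw_def by blast
  obtain Q where Q_lin: "linear Q" and Q: "\<And>v. v \<in> W \<Longrightarrow> Q v = P v"
    using prolongation_linear_extension[OF assms(10)[unfolded W_def]] unfolding W_def by blast
  have P0: "P 0 = 0" using Q[OF W0] linear_0[OF Q_lin] by simp
  have Q_cont: "continuous_on UNIV Q"
    using linear_continuous_on_compose[OF continuous_on_id Q_lin] .

  \<comment> \<open>Splitting the functional along \<open>w + V\<close>\<close>
  \<comment> \<open>\<open>c w\<close> collects the blocks other than \<open>k\<close>. Since
    \<open>R i\<close> vanishes on \<open>V\<close> for these, it is constant along
    \<open>w + V\<close>.\<close>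
  define c where "c w = (\<Sum>i\<in>{1..m} - {k}. \<phi> i (R i w))" for w
  have J_split: "J (w + P v) = f w v + c w" if v: "v \<in> W" for w v
  proof -
    have "R i (w + P v) = R i w" if "i \<in> {1..m} - {k}" for i
      using R_zero[OF _ _ PV[OF v]] block(1)[of i] that by (auto simp: linear_add)
    moreover have "R k (w + P v) = R k w + v"
      using RP[OF v] R_lin by (simp add: linear_add)
    ultimately show ?thesis
      unfolding J_eq f_def f\<^sub>0_def \<psi>_def c_def
      using sum.remove[of "{1..m}" k "\<lambda>i. \<phi> i (R i (w + P v))"] \<open>k \<in> {1..m}\<close>
      by (simp add: add.assoc)
  qed
  have J_split0: "J w = f w 0 + c w" for w
    using J_split[OF W0, of w] P0 by simp
  have c_ninf: "c w \<noteq> -\<infinity>" for w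
    unfolding c_def using \<phi>_ninf by (intro sum_not_MInfty) auto
  \<comment> \<open>No summand is \<open>-\<infinity>\<close>, so finiteness of the sum passes to
    each summand.\<close>
  have fin: "\<bar>c w\<bar> \<noteq> \<infinity>" "\<phi> k (R k w) < \<infinity>" "\<bar>J w\<bar> \<noteq> \<infinity>" if "w \<in> edom J" for w
  proof -
    have "J w < \<infinity>" using that by (simp add: edom_def)
    moreover have "J w = ereal (J\<^sub>0 w) + \<phi> k (R k w) + c w"
      using J_split0[of w] P0 by (simp add: f_def f\<^sub>0_def \<psi>_def)
    ultimately show "\<bar>c w\<bar> \<noteq> \<infinity>" "\<phi> k (R k w) < \<infinity>" "\<bar>J w\<bar> \<noteq> \<infinity>"
      using c_ninf[of w] \<phi>k_ninf[OF RW, of w]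
      by (cases "c w"; cases "\<phi> k (R k w)"; simp)+
  qed

  \<comment> \<open>Descent through the dominating model\<close>
  have model: "first_order_model W (f\<^sub>0 w) (\<psi> w) (M w)" and dom: "v \<in> W \<Longrightarrow> f w v \<le> M w v"
    if "w \<in> edom J" for w v
    using assms(17)[OF that] unfolding dominating_first_order_model_def f_def by auto
  have M_zero: "M w 0 = f w 0" if "w \<in> edom J" for w
    using first_order_model_zero[OF model[OF that] W(1)] by (simp add: f_def)
  have descent: "J (w + P v) \<le> J w" if "w \<in> edom J" "v \<in> W" "M w v \<le> M w 0" for w v
    using that dom[of w v] M_zero[of w] unfolding J_split[OF that(2)] J_split0[of w]
    by (intro add_right_mono) auto
  have strict_descent: "J (w + P v) < J w" if "w \<in> edom J" "v \<in> W" "M w v < M w 0" for w v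
  proof -
    have "f w v < f w 0" using that dom[of w v] M_zero[of w] by (metis le_less_trans)
    \<comment> \<open>Adding \<open>c w\<close> preserves the strict inequality because
      \<open>c w\<close> is finite.\<close>
    then show ?thesis
      unfolding J_split[OF that(2)] J_split0[of w] using fin(1)[OF that(1)]
      by (cases "c w"; cases "f w v"; cases "f w 0") auto
  qed

  \<comment> \<open>The model in the variable \<open>u = R k w + v\<close>\<close>
  \<comment> \<open>Writing the linear term with \<open>J'\<close> and \<open>Q\<close> exhibits
    joint continuity in \<open>w\<close> and \<open>u\<close>; \<open>frechet\<close> below
    identifies it with the derivative used in \<open>M\<close>.\<close>
  define g where "g w u = J\<^sub>0 w + J' w (Q (u - R k w)) + M\<^sub>0 (u - R k w)" for w u
  have diffW: "u - R k w \<in> W" if "u \<in> W" for u w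
    using W(1) that RW by (rule subspace_diff)
  \<comment> \<open>Both sides are the derivative at 0 of the same real function
    \<open>t \<mapsto> J\<^sub>0 (w + t *\<^sub>R P v)\<close>.\<close>
  have frechet: "frechet_derivative (f\<^sub>0 w) (at 0 within W) v = J' w (Q v)"
    if "w \<in> edom J" "v \<in> W" for w v
  proof (rule DERIV_unique)
    have "C1_on W (f\<^sub>0 w)"
      using model[OF that(1)] by (simp add: first_order_model_def)
    then show "((\<lambda>t. f\<^sub>0 w (0 + t *\<^sub>R v)) has_real_derivative
        frechet_derivative (f\<^sub>0 w) (at 0 within W) v) (at 0)"
      using has_real_derivative_along_line[of "f\<^sub>0 w" _ 0 0 v W]
        C1_on_has_frechet_derivative[of W "f\<^sub>0 w" 0] W(1) W0 that(2) by simp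
    have "f\<^sub>0 w (0 + t *\<^sub>R v) = J\<^sub>0 (w + t *\<^sub>R Q v)" for t
      using Q[of "t *\<^sub>R v"] W(1) that(2) linear_cmul[OF Q_lin, of t v]
      by (simp add: f\<^sub>0_def subspace_scale)
    then show "((\<lambda>t. f\<^sub>0 w (0 + t *\<^sub>R v)) has_real_derivative J' w (Q v)) (at 0)"
      using has_real_derivative_along_line[of J\<^sub>0 "J' w" w 0 "Q v" UNIV] J'[of w] by simp
  qed
  have M_g: "M w (u - R k w) = ereal (g w u) + \<phi> k u" if "w \<in> edom J" "u \<in> W" for w u
    using frechet[OF that(1) diffW[OF that(2)]] P0 unfolding M_def g_def \<psi>_def f\<^sub>0_def by simp
  have M_g0: "M w 0 = ereal (g w (R k w)) + \<phi> k (R k w)" if "w \<in> edom J" for w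
    using M_g[OF that RW, of w] by simp
  have g_cont: "continuous_on (A \<times> W) (\<lambda>(w, u). g w u)" for A
  proof -
    have 1: "continuous_on (A \<times> W) (\<lambda>x. snd x - R k (fst x))"
      by (intro continuous_intros continuous_on_compose2[OF R_cont[of UNIV]]) auto
    have 2: "continuous_on (A \<times> W) (\<lambda>x. M\<^sub>0 (snd x - R k (fst x)))"
      by (rule continuous_on_compose2[OF C1_on_imp_continuous_on[OF \<open>C1_on W M\<^sub>0\<close>] 1])
        (use diffW in auto)
    have 3: "continuous_on (A \<times> W) (\<lambda>x. J' (fst x))" "continuous_on (A \<times> W) (\<lambda>x. J\<^sub>0 (fst x))"
      by (rule continuous_on_compose2[OF J'_cont] continuous_on_compose2[OF J0_cont];
          auto intro: continuous_intros)+
    show ?thesis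
      unfolding g_def case_prod_beta by (intro continuous_intros 1 2 3 continuous_on_compose2[OF Q_cont]) auto
  qed
  have g_cont1: "continuous_on W (g w)" for w
  proof -
    have "continuous_on W (\<lambda>u. (w, u))"
      by (intro continuous_on_Pair continuous_on_const continuous_on_id)
    then show ?thesis
      using continuous_on_compose2[OF g_cont[of "{w}"], of W "\<lambda>u. (w, u)"] by auto
  qed
  \<comment> \<open>The preimage is \<open>w + P (u - R k w)\<close>. The bounding set depends on
    \<open>w\<close> only through the level \<open>J w\<close>, which later makes the bound uniform
    for nearby points.\<close>
  have sublevel: "u \<in> R k ` {x. J x \<le> J w}"
    if w: "w \<in> edom J" and u: "u \<in> W" "ereal (g w u) + \<phi> k u \<le> ereal (g w (R k w)) + \<phi> k (R k w)" for w u
  proof (rule image_eqI)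
    show "w + P (u - R k w) \<in> {x. J x \<le> J w}"
      using u(2) by (intro CollectI descent w diffW u(1)) (simp only: M_g[OF w u(1)] M_g0[OF w])
    show "u = R k (w + P (u - R k w))"
      using RP[OF diffW[OF u(1)]] R_lin by (simp add: linear_add)
  qed
  have R_bdd: "bounded (R k ` {x. J x \<le> ereal r})" for r
    using bounded_linear_image[OF coercive_bounded_sublevel[OF \<open>coercive J\<close>]] R_lin
    by (simp add: linear_conv_bounded_linear)

  \<comment> \<open>Existence and uniqueness of the minimizer\<close>
  have "\<exists>u\<in>W. \<forall>u'\<in>W. ereal (g w u) + \<phi> k u \<le> ereal (g w u') + \<phi> k u'" if w: "w \<in> edom J" for w
  \<comment> \<open>The base point \<open>R k w\<close> corresponds to \<open>v = 0\<close>, where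
    \<open>\<phi> k\<close> is finite.\<close>
  proof (rule exists_minimizer_continuous_plus_lsc[OF W(2) g_cont1 \<phi>_lsc RW fin(2)[OF w]])
    obtain r where "J w = ereal r" using fin(3)[OF w] by auto
    then show "bounded {u \<in> W. ereal (g w u) + \<phi> k u \<le> ereal (g w (R k w)) + \<phi> k (R k w)}"
      using sublevel[OF w] by (intro bounded_subset[OF R_bdd[of r]]) auto
  qed
  then have "\<forall>w. \<exists>u. w \<in> edom J \<longrightarrow> u \<in> W \<and>
      (\<forall>u'\<in>W. ereal (g w u) + \<phi> k u \<le> ereal (g w u') + \<phi> k u')"
    by blast
  then obtain U where "\<forall>w. w \<in> edom J \<longrightarrow> U w \<in> W \<and>
      (\<forall>u'\<in>W. ereal (g w (U w)) + \<phi> k (U w) \<le> ereal (g w u') + \<phi> k u')"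
    using choice[of "\<lambda>w u. w \<in> edom J \<longrightarrow> u \<in> W \<and>
      (\<forall>u'\<in>W. ereal (g w u) + \<phi> k u \<le> ereal (g w u') + \<phi> k u')"] by blast
  then have UW: "U w \<in> W"
    and U_min: "u' \<in> W \<Longrightarrow> ereal (g w (U w)) + \<phi> k (U w) \<le> ereal (g w u') + \<phi> k u'"
    if "w \<in> edom J" for w u'
    using that by blast+
  have U_fin: "\<bar>\<phi> k (U w)\<bar> \<noteq> \<infinity>" if w: "w \<in> edom J" for w
    using U_min[OF w RW, of w] fin(2)[OF w] \<phi>k_ninf[OF UW[OF w]]
    by (cases "\<phi> k (U w)"; cases "\<phi> k (R k w)") auto
  have U_unique: "u = U w" if w: "w \<in> edom J" and u: "u \<in> W"
    and le: "ereal (g w u) + \<phi> k u \<le> ereal (g w (U w)) + \<phi> k (U w)" for w u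
  proof (rule ccontr)
    assume ne: "u \<noteq> U w"
    \<comment> \<open>The midpoint would beat both minimizers: \<open>\<phi> k\<close> is convex,
      the derivative term is affine in \<open>u\<close>, and \<open>M\<^sub>0\<close> is strictly
      midpoint convex.\<close>
    define z where "z = (1/2) *\<^sub>R u + (1/2) *\<^sub>R U w"
    have zW: "z \<in> W" unfolding z_def using W(1) u UW[OF w] by (intro subspace_add subspace_scale)
    obtain b where b: "\<phi> k (U w) = ereal b" using U_fin[OF w] by auto
    obtain a where a: "\<phi> k u = ereal a"
      using le b \<phi>k_ninf[OF u] by (cases "\<phi> k u") auto
    have "\<phi> k z \<le> ereal (1/2) * \<phi> k u + ereal (1/2) * \<phi> k (U w)"
      using \<phi>_conv[unfolded econvex_on_def, rule_format, OF u UW[OF w], of "1/2"] by (simp add: z_def)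
    then obtain d where d: "\<phi> k z = ereal d" "d \<le> (a + b) / 2"
      using a b \<phi>k_ninf[OF zW] by (cases "\<phi> k z") (auto simp: field_simps)
    have zR: "z - R k w = (1/2) *\<^sub>R (u - R k w) + (1/2) *\<^sub>R (U w - R k w)"
    proof -
      have "R k w = (1/2) *\<^sub>R R k w + (1/2) *\<^sub>R R k w" by (simp flip: scaleR_left_distrib)
      then show ?thesis by (simp add: z_def algebra_simps)
    qed
    have "M\<^sub>0 (z - R k w) < (M\<^sub>0 (u - R k w) + M\<^sub>0 (U w - R k w)) / 2"
      unfolding zR using ne
      by (intro uniformly_monotone_derivative_midpoint_less[OF assms(18) \<open>C1_on W M\<^sub>0\<close> W(1)] diffW u UW w) auto
    moreover have "J' w (Q (z - R k w)) = (J' w (Q (u - R k w)) + J' w (Q (U w - R k w))) / 2"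
      unfolding zR by (simp add: linear_add[OF Q_lin] linear_cmul[OF Q_lin] blinfun.bilinear_simps)
    ultimately have "g w z < (g w u + g w (U w)) / 2"
      unfolding g_def by simp
    then show False
      using U_min[OF w zW] le a b d by simp
  qed

  \<comment> \<open>Continuity of the minimizer in \<open>w\<close>\<close>
  have U_cont: "continuous_on (edom J) U"
  proof (rule continuous_on_unique_minimizer[OF W(2) g_cont \<phi>_lsc UW U_fin U_min U_unique])
    fix w assume w: "w \<in> edom J"
    obtain r where r: "J w = ereal r" using fin(3)[OF w] by auto
    have "(J \<longlongrightarrow> J w) (at w within edom J)"
      using \<open>continuous_on (edom J) J\<close> w by (auto simp: continuous_on_def)
    \<comment> \<open>Continuity of \<open>J\<close> on its domain gives one level for all
      \<open>y\<close> near \<open>w\<close>; the margin 1 is arbitrary.\<close>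
    then have "\<forall>\<^sub>F y in at w within edom J. J y < ereal (r + 1)"
      by (rule order_tendstoD) (simp add: r)
    moreover have "\<forall>\<^sub>F y in at w within edom J. y \<in> edom J"
      by (simp add: eventually_at_filter)
    ultimately have "\<forall>\<^sub>F y in at w within edom J. U y \<in> R k ` {x. J x \<le> ereal (r + 1)}"
    proof eventually_elim
      case (elim y)
      then show ?case
        using sublevel[OF elim(2) UW[OF elim(2)] U_min[OF elim(2) RW]] by force
    qed
    then show "\<exists>B. bounded B \<and> (\<forall>\<^sub>F y in at w within edom J. U y \<in> B)"
      using R_bdd by blast
  qed

  \<comment> \<open>The minimization operator\<close>
  define S where "S w = w + P (U w - R k w)" for w
  have arg: "is_arg_min (M w) (\<lambda>v. v \<in> W) v \<longleftrightarrow> v = U w - R k w" if w: "w \<in> edom J" for w v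
  proof
    assume v: "is_arg_min (M w) (\<lambda>v. v \<in> W) v"
    then have vW: "v \<in> W" and le: "M w v \<le> M w (U w - R k w)"
      using diffW[OF UW[OF w]] by (auto simp: is_arg_min_def not_less)
    have "v + R k w \<in> W" using W(1) vW RW by (rule subspace_add)
    then have "v + R k w = U w"
      using U_unique[OF w] le M_g[OF w, of "v + R k w"] M_g[OF w UW[OF w]] by simp
    then show "v = U w - R k w" by (simp add: eq_diff_eq)
  next
    assume v: "v = U w - R k w"
    have "M w v \<le> M w v'" if "v' \<in> W" for v'
    proof -
      have "v' + R k w \<in> W" using W(1) that RW by (rule subspace_add)
      then show ?thesis
        using U_min[OF w] M_g[OF w, of "v' + R k w"] M_g[OF w UW[OF w]] v by simp
    qed
    then show "is_arg_min (M w) (\<lambda>v. v \<in> W) v"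
      using diffW[OF UW[OF w]] v by (auto simp: is_arg_min_def not_less)
  qed
  \<comment> \<open>\<open>arg_min_on\<close> picks some minimizer; uniqueness makes it
    \<open>U w - R k w\<close>.\<close>
  have S: "w + P (arg_min_on (M w) W) = S w" if "w \<in> edom J" for w
    using arg[OF that] by (simp add: S_def arg_min_on_def arg_min_def)
  have M_min: "M w (U w - R k w) \<le> M w v" if "w \<in> edom J" "v \<in> W" for w v
    using arg[OF that(1), of "U w - R k w"] that(2) by (auto simp: is_arg_min_def not_less)
  have S_le: "J (S w) \<le> J w" if w: "w \<in> edom J" for w
    unfolding S_def by (intro descent w diffW UW M_min W0)
  have S_dom: "S w \<in> edom J" if "w \<in> edom J" for w
    using le_less_trans[OF S_le[OF that], of \<infinity>] that unfolding edom_def by blast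
  have SV: "S w - w \<in> V" if "w \<in> edom J" for w
    using PV[OF diffW[OF UW[OF that]]] by (simp add: S_def)
  have S_less: "J (S w) < J w" if w: "w \<in> edom J" and not_min: "\<not> (\<forall>v\<in>V. J w \<le> J (w + v))" for w
  proof -
    obtain v where v: "v \<in> W" "J (w + P v) < J w"
      using not_min V_img by (auto simp: not_le)
    \<comment> \<open>By contraposition: \<open>f w 0 \<le> f w v\<close> would persist after adding
      \<open>c w\<close>.\<close>
    have "f w v < f w 0"
      using v(2) add_right_mono[of "f w 0" "f w v" "c w"]
      unfolding J_split[OF v(1)] J_split0[of w] by (auto simp flip: not_le)
    then have "\<exists>u\<in>W. M w u < M w 0"
      using assms(15)[OF w] v(1) \<phi>k_ninf W(1) RW
      by (intro first_order_model_descent[OF model[OF w] W(1), of v])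
        (auto simp: f_def \<psi>_def subspace_add)
    then show ?thesis
      unfolding S_def using M_min[OF w] by (intro strict_descent w diffW UW) (auto intro: le_less_trans)
  qed
  have "continuous_on (edom J) S"
  proof -
    \<comment> \<open>\<open>Q\<close> stands in for \<open>P\<close>, being continuous everywhere
      and equal to \<open>P\<close> at \<open>U w - R k w\<close>, which lies in
      \<open>W\<close>.\<close>
    have "continuous_on (edom J) (\<lambda>w. w + Q (U w - R k w))"
      by (intro continuous_intros continuous_on_compose2[OF Q_cont] U_cont R_cont) auto
    then show ?thesis
      by (rule continuous_on_eq) (simp add: S_def Q diffW UW)
  qed
  then have "continuous_on (edom J) (J \<circ> S)"
    using S_dom by (intro continuous_on_compose continuous_on_subset[OF \<open>continuous_on (edom J) J\<close>]) auto
  then have "inexact_minimization_operator J V (\<lambda>w. w + P (arg_min_on (M w) W))"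
    unfolding inexact_minimization_operator_def using S S_dom SV S_le S_less
    by (intro conjI ballI exI[of _ S]) auto
  then show ?thesis using arg by auto
qed

end
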